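(* Let $M\in\mathcal{LC}$. Then every sequence of positive integers $(a_j)_{j\ge1}$ which is a sequence of Lusky numbers for $M$ satisfies $$a_{j+1}-a_j\ge2\quad\text{for all } j\ge1,\qquad\text{and}\qquad\sum_{j=1}^{+\infty}\frac{1}{a_{j+1}-a_j}=+\infty.$$
   Context: $\mathbb{N}=\{0,1,2,\dots\}$. For a sequence $M=(M_p)_{p\in\mathbb{N}}$ of positive reals put $\mu_p:=M_p/M_{p-1}$ for $p\ge1$ and $\mu_0:=1$. $\mathcal{LC}$ is the set of all such $M$ with $M_0=1\le M_1$, $M_p^2\le M_{p-1}M_{p+1}$ for all $p\ge1$, and $\lim_{p\to\infty}(M_p)^{1/p}=+\infty$. For integers $0\le k<l$, $$A_M(k,l):=\frac{(\mu_{l+1})^{l-k}}{\mu_{k+1}\cdots\mu_l},\qquad B_M(k,l):=\frac{\mu_{k+1}\cdots\mu_l}{(\mu_{k+1})^{l-k}}.$$ A strictly increasing sequence of nonnegative integers $(a_j)_{j\ge1}$ is called a sequence of Lusky numbers for $M$ if there exist constants $K\ge b>2$ such that for all $j\ge1$: $b\le\min\{A_M(a_j,a_{j+1}),B_M(a_j,a_{j+1})\}\le\max\{A_M(a_j,a_{j+1}),B_M(a_j,a_{j+1})\}\le K$. *)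

theory Defs
  imports Complex_Main
begin

definition quotient_seq :: "(nat \<Rightarrow> real) \<Rightarrow> nat \<Rightarrow> real" where
  "quotient_seq M p = (if p = 0 then 1 else M p / M (p - 1))"

definition LC :: "(nat \<Rightarrow> real) set" where
  "LC = {M. (\<forall>p. M p > 0) \<and> M 0 = 1 \<and> 1 \<le> M 1 \<and>
            (\<forall>p\<ge>1. (M p)\<^sup>2 \<le> M (p - 1) * M (p + 1)) \<and>
            filterlim (\<lambda>p. root p (M p)) at_top sequentially}"

text \<open>The following two quantities are only meant for \<open>k < l\<close>.\<close>

definition lusky_A :: "(nat \<Rightarrow> real) \<Rightarrow> nat \<Rightarrow> nat \<Rightarrow> real" where
  "lusky_A M k l = quotient_seq M (l + 1) ^ (l - k) / (\<Prod>i=k+1..l. quotient_seq M i)"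

definition lusky_B :: "(nat \<Rightarrow> real) \<Rightarrow> nat \<Rightarrow> nat \<Rightarrow> real" where
  "lusky_B M k l = (\<Prod>i=k+1..l. quotient_seq M i) / quotient_seq M (k + 1) ^ (l - k)"

text \<open>Sequences \<open>(a\<^sub>j)\<close>, \<open>j \<ge> 1\<close>, are functions on \<^typ>\<open>nat\<close> whose value at \<open>0\<close> is irrelevant.\<close>

definition lusky_numbers :: "(nat \<Rightarrow> real) \<Rightarrow> (nat \<Rightarrow> nat) \<Rightarrow> bool" where
  "lusky_numbers M a \<longleftrightarrow>
     strict_mono_on {1..} a \<and>
     (\<exists>K b :: real. K \<ge> b \<and> b > 2 \<and>
        (\<forall>j\<ge>1.
           b \<le> min (lusky_A M (a j) (a (j + 1))) (lusky_B M (a j) (a (j + 1))) \<and>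
           min (lusky_A M (a j) (a (j + 1))) (lusky_B M (a j) (a (j + 1)))
             \<le> max (lusky_A M (a j) (a (j + 1))) (lusky_B M (a j) (a (j + 1))) \<and>
           max (lusky_A M (a j) (a (j + 1))) (lusky_B M (a j) (a (j + 1))) \<le> K))"

end

theory Submission
  imports Defs
begin

text \<open>
  Write \<open>\<mu>\<close> for the quotient sequence of \<open>M\<close>. In the product \<open>A\<^sub>M(k,l) B\<^sub>M(k,l)\<close> the factors
  \<open>\<mu>\<^sub>k\<^sub>+\<^sub>1, \<dots>, \<mu>\<^sub>l\<close> cancel, and what remains is \<open>(\<mu>\<^sub>l\<^sub>+\<^sub>1 / \<mu>\<^sub>k\<^sub>+\<^sub>1)\<^sup>l\<^sup>-\<^sup>k\<close>. Along Lusky numbers this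
  product is at most \<open>K\<^sup>2\<close>, so the increment of \<open>ln \<mu>\<close> from \<open>a\<^sub>j + 1\<close> to \<open>a\<^sub>j\<^sub>+\<^sub>1 + 1\<close> is at most
  \<open>2 ln K / (a\<^sub>j\<^sub>+\<^sub>1 - a\<^sub>j)\<close>. The increments telescope, and log-convexity together with the growth
  condition on \<open>M\<close> forces \<open>\<mu>\<close> to tend to infinity; therefore the reciprocals of the gaps cannot
  have a bounded sum. A gap of length one is excluded because then \<open>B\<^sub>M\<close> would be equal to \<open>1 < b\<close>.
\<close>

lemma quotient_seq_pos:
  assumes "M \<in> LC"
  shows "quotient_seq M p > 0"
  using assms by (auto simp: LC_def quotient_seq_def)

lemma quotient_seq_incseq:
  assumes "M \<in> LC"
  shows "incseq (quotient_seq M)"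
proof (rule incseq_SucI)
  fix p
  have pos: "M i > 0" for i
    using assms by (auto simp: LC_def)
  show "quotient_seq M p \<le> quotient_seq M (Suc p)"
  proof (cases "p = 0")
    case True
    then show ?thesis
      using assms by (auto simp: LC_def quotient_seq_def)
  next
    case False
    then have "(M p)\<^sup>2 \<le> M (p - 1) * M (p + 1)"
      using assms by (auto simp: LC_def)
    then show ?thesis
      using False pos[of p] pos[of "p - 1"]
      by (simp add: quotient_seq_def field_simps power2_eq_square)
  qed
qed

text \<open>
  \<open>M\<^sub>p\<close> is the product of the first \<open>p\<close> quotients, so a bound \<open>C\<close> for the quotients would also
  bound \<open>(M\<^sub>p)\<^sup>1\<^sup>/\<^sup>p\<close>. Hence the quotients are unbounded, and by monotonicity they diverge.
\<close>

lemma quotient_seq_at_top: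
  assumes "M \<in> LC"
  shows "filterlim (quotient_seq M) at_top sequentially"
proof -
  have pos: "M i > 0" for i
    using assms by (auto simp: LC_def)
  have "\<exists>p. quotient_seq M p > C" for C
  proof (rule ccontr)
    assume "\<nexists>p. quotient_seq M p > C"
    then have le: "quotient_seq M p \<le> C" for p
      by (simp add: not_less)
    have C: "C \<ge> 1"
      using le[of 0] by (simp add: quotient_seq_def)
    have bound: "M p \<le> C ^ p" for p
    proof (induction p)
      case 0
      then show ?case
        using assms by (auto simp: LC_def)
    next
      case (Suc p)
      have "M (Suc p) \<le> C * M p"
        using le[of "Suc p"] pos[of p] by (simp add: quotient_seq_def field_simps)
      also have "\<dots> \<le> C * C ^ p"
        using Suc C by (intro mult_left_mono) auto
      finally show ?case
        by simp
    qed
    have "eventually (\<lambda>p. root p (M p) > C) sequentially"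
      using assms by (auto simp: LC_def filterlim_at_top_dense)
    then obtain p where p: "p \<ge> 1" "root p (M p) > C"
      by (metis eventually_sequentially nle_le)
    have "root p (M p) \<le> root p (C ^ p)"
      using p bound by simp
    also have "\<dots> = C"
      using p C by (simp add: real_root_power_cancel)
    finally show False
      using p by simp
  qed
  then have "\<exists>N. \<forall>p\<ge>N. C \<le> quotient_seq M p" for C
    by (meson quotient_seq_incseq[OF assms] incseqD less_imp_le order_trans)
  then show ?thesis
    by (simp add: filterlim_at_top eventually_sequentially)
qed

lemma lusky_A_mult_lusky_B:
  assumes "M \<in> LC"
  shows "lusky_A M k l * lusky_B M k l =
         (quotient_seq M (l + 1) / quotient_seq M (k + 1)) ^ (l - k)"
proof -
  have "(\<Prod>i=k+1..l. quotient_seq M i) \<noteq> 0"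
    using quotient_seq_pos[OF assms] by (intro less_imp_neq[THEN not_sym] prod_pos) auto
  then show ?thesis
    by (simp add: lusky_A_def lusky_B_def power_divide del: prod_zero_iff)
qed

lemma lusky_AB_pos:
  assumes "M \<in> LC"
  shows "lusky_A M k l > 0" "lusky_B M k l > 0"
  using quotient_seq_pos[OF assms]
  by (auto simp: lusky_A_def lusky_B_def intro!: divide_pos_pos prod_pos)

lemma ln_quotient_seq_increment_le:
  assumes "M \<in> LC" "k < l" "lusky_A M k l \<le> K" "lusky_B M k l \<le> K"
  shows "ln (quotient_seq M (l + 1)) - ln (quotient_seq M (k + 1)) \<le>
         2 * ln K * (1 / (real l - real k))"
proof -
  let ?q = "quotient_seq M (l + 1) / quotient_seq M (k + 1)"
  have q: "?q > 0"
    using quotient_seq_pos[OF assms(1)] by simp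
  have K: "K > 0"
    using lusky_AB_pos(1)[OF assms(1), of k l] assms(3) by linarith
  have "?q ^ (l - k) \<le> K * K"
    unfolding lusky_A_mult_lusky_B[OF assms(1), symmetric]
    using assms(3,4) lusky_AB_pos[OF assms(1), of k l] K by (intro mult_mono) auto
  then have "ln (?q ^ (l - k)) \<le> ln (K * K)"
    using q K by (subst ln_le_cancel_iff) auto
  then have "real (l - k) * ln ?q \<le> 2 * ln K"
    using q K by (simp add: ln_realpow ln_mult)
  then have "ln ?q \<le> 2 * ln K * (1 / (real l - real k))"
    using assms(2) by (simp add: of_nat_diff pos_le_divide_eq mult.commute)
  moreover have "ln ?q = ln (quotient_seq M (l + 1)) - ln (quotient_seq M (k + 1))"
    using quotient_seq_pos[OF assms(1), of "l + 1"] quotient_seq_pos[OF assms(1), of "k + 1"]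
    by (simp add: ln_div)
  ultimately show ?thesis
    by simp
qed

theorem corollary5p7:
  fixes M :: "nat \<Rightarrow> real" and a :: "nat \<Rightarrow> nat"
  assumes "M \<in> LC"
    and "\<forall>j\<ge>1. a j > 0"
    and "lusky_numbers M a"
  shows "(\<forall>j\<ge>1. int (a (j + 1)) - int (a j) \<ge> 2) \<and>
         filterlim (\<lambda>n. \<Sum>j=1..n. 1 / (real (a (j + 1)) - real (a j))) at_top sequentially"
proof -
  define gap_sum where
    "gap_sum n = (\<Sum>j=1..n. 1 / (real (a (j + 1)) - real (a j)))" for n
  from assms(3) obtain K b :: real where mono: "strict_mono_on {1..} a" and "b > 2" "K \<ge> b"
    and AB: "\<And>j. j \<ge> 1 \<Longrightarrow> lusky_A M (a j) (a (j + 1)) \<le> K"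
            "\<And>j. j \<ge> 1 \<Longrightarrow> lusky_B M (a j) (a (j + 1)) \<le> K"
            "\<And>j. j \<ge> 1 \<Longrightarrow> b \<le> lusky_B M (a j) (a (j + 1))"
    unfolding lusky_numbers_def by auto
  have less: "a j < a (j + 1)" if "j \<ge> 1" for j
    using mono that by (auto simp: strict_mono_on_def)
  have gap: "a (j + 1) \<ge> a j + 2" if "j \<ge> 1" for j
  proof (rule ccontr)
    assume "\<not> ?thesis"
    then have "a (j + 1) = a j + 1"
      using less[OF that] by linarith
    then have "lusky_B M (a j) (a (j + 1)) = 1"
      using quotient_seq_pos[OF assms(1), of "a j + 1"] by (simp add: lusky_B_def)
    then show False
      using AB(3)[OF that] \<open>b > 2\<close> by simp
  qed
  have telescope: "ln (quotient_seq M (a (n + 1) + 1)) - ln (quotient_seq M (a 1 + 1))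
      \<le> 2 * ln K * gap_sum n" for n
  proof (induction n)
    case 0
    then show ?case
      by (simp add: gap_sum_def)
  next
    case (Suc n)
    show ?case
      using Suc
        ln_quotient_seq_increment_le[OF assms(1) less AB(1) AB(2), of "Suc n"]
      by (simp add: gap_sum_def distrib_left)
  qed
  have "strict_mono (\<lambda>n. a (n + 1) + 1)"
    using less by (auto simp: strict_mono_Suc_iff)
  then have "filterlim (\<lambda>n. a (n + 1) + 1) at_top sequentially"
    by (rule filterlim_subseq)
  then have "filterlim (\<lambda>n. ln (quotient_seq M (a (n + 1) + 1))) at_top sequentially"
    by (intro filterlim_compose[OF ln_at_top] filterlim_compose[OF quotient_seq_at_top[OF assms(1)]])
  then have "filterlim (\<lambda>n. - ln (quotient_seq M (a 1 + 1)) + ln (quotient_seq M (a (n + 1) + 1)))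
      at_top sequentially"
    by (intro filterlim_tendsto_add_at_top[OF tendsto_const])
  then have "filterlim (\<lambda>n. 2 * ln K * gap_sum n) at_top sequentially"
    using telescope by (elim filterlim_at_top_mono) (auto intro!: always_eventually simp: algebra_simps)
  moreover have "0 < 2 * ln K"
    using \<open>b > 2\<close> \<open>K \<ge> b\<close> by simp
  ultimately have "filterlim gap_sum at_top sequentially"
    using filterlim_tendsto_pos_mult_at_top[OF tendsto_const[of "1 / (2 * ln K)" sequentially], of
        "\<lambda>n. 2 * ln K * gap_sum n"] by simp
  then show ?thesis
    using gap unfolding gap_sum_def by force
qed

end
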